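(* Let $n\ge1$, $q\in\mathbb Z/4\mathbb Z$, $s\in\mathbb C$. For a $\lambda$-admissible pair $(l,k)$ (with $\lambda$ an admissible eigenvalue) and $h_k\in\mathcal H_k(\mathbb R^n)$ non-zero, let $F_{m,l,k}$, $m\in\mathbb Z$, $m\equiv2k+q\pmod 4$, be the functions built from $h_k$. Then for the $\mathfrak{sl}_2$-triple $\{\eta^+,\kappa,\eta^-\}$, $$\kappa.F_{m,l,k}(\theta,y)=\frac m2F_{m,l,k}(\theta,y),\qquad \eta^{\pm}.F_{m,l,k}(\theta,y)=-\frac{\pm m+4l+2k+n}{4}\,F_{m\pm4,l,k}(\theta,y).$$ Lowest weight vectors occur if and only if $q\equiv n\pmod 4$ and, in this case, $$F_{(2k+4l+n),\,l,k}=e^{-\frac12(2k+4l+n)i\theta}\,e^{is\rho^2}\rho^{2l}h_k$$ is a lowest weight vector. Highest weight vectors occur if and only if $q+n\equiv0\pmod 4$ and, in this case, $$F_{-(2k+4l+n),\,l,k}=e^{\frac12(2k+4l+n)i\theta}\,e^{-is\rho^2}\rho^{2l}h_k$$ is a highest weight vector.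
   Context: Coordinates are $\theta\in\mathbb R$, $y\in\mathbb R^n$, $\rho=\|y\|$. $\mathcal H_k(\mathbb R^n)$ is the space of harmonic polynomials of homogeneous degree $k$ on $\mathbb R^n$; the index $k$ runs over $\mathbb Z^{\ge0}$ for $n\ge3$, over $\mathbb Z$ for $n=2$, and over $\{0,1\}$ for $n=1$, these being the indices in the decomposition $C^\infty(S^{n-1})_{O(n)\text{-finite}}=\bigoplus_k\mathcal H_k(S^{n-1})$, with $\mathcal H_k(S^{n-1})$ the restrictions to the sphere. With ${}_1F_1(a,b,z)=\sum_{j\ge0}\frac{(a)_j}{(b)_j}\frac{z^j}{j!}$, put for $h_k\in\mathcal H_k(\mathbb R^n)$ $$F_{m,l,k}(\theta,y)=e^{-im\theta/2}e^{-is\rho^2}\rho^{2l}h_k(y)\,{}_1F_1\!\Big(\tfrac{m+4l+2k+n}{4},\,2l+k+\tfrac n2,\,2is\rho^2\Big).$$ The $\mathfrak{sl}_2$-triple $\{\eta^+,\kappa,\eta^-\}$ of $\mathfrak{sl}_2(\mathbb C)$ acts by the differential operators $$\kappa=i\partial_\theta,\qquad \eta^\pm=\tfrac12e^{\mp2i\theta}\Big(-E_n\mp i\partial_\theta-\big(\tfrac n2\pm2is\|y\|^2\big)\Big),\qquad E_n=\sum_{j=1}^n y_j\partial_{y_j}.$$ A lowest (respectively highest) weight vector is a non-zero $\kappa$-eigenvector annihilated by $\eta^-$ (respectively $\eta^+$). Admissible eigenvalues: for $n=1$, $\lambda$ is admissible iff $\lambda=\frac12l(l-1)$ for some $l\in\mathbb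 Z^{\ge0}$. For $n\ge2$, $\lambda$ is admissible iff $\lambda\in A_n=\{l(n+2j)\mid l,j\in\mathbb Z,\ 1\le l\le j+1\}$. Admissible pairs, for $\lambda$ admissible: for $n\ge3$, a pair $(l,k)\in\mathbb Z^{\ge1}\times\mathbb Z^{\ge0}$ is $\lambda$-admissible iff $\lambda=l(2l+2k+n-2)$. For $n=2$, a pair $(l,k)\in\mathbb Z^{\ge1}\times\mathbb Z$ is $\lambda$-admissible iff $\lambda=l(2l+2k+n-2)$. For $n=1$, a pair $(l,0)$, $l\in\mathbb Z^{\ge0}$, is $\lambda$-admissible iff $\lambda=\frac{l(l-1)}2$. *)

theory Defs
  imports "HOL-Analysis.Analysis" "HOL-Number_Theory.Cong"
begin

text \<open>
  The space \<open>\<real>\<^sup>n\<close> is \<^typ>\<open>real ^ 'n\<close> with \<open>n = CARD('n)\<close>; functions of \<open>(\<theta>, y)\<close> are curried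
  and complex-valued.
\<close>

definition partial_deriv :: "'n \<Rightarrow> (real ^ 'n \<Rightarrow> complex) \<Rightarrow> real ^ 'n \<Rightarrow> complex" where
  "partial_deriv j f y = vector_derivative (\<lambda>t. f (y + t *\<^sub>R axis j 1)) (at 0)"

definition laplacian :: "(real ^ 'n \<Rightarrow> complex) \<Rightarrow> real ^ 'n \<Rightarrow> complex" where
  "laplacian f y = (\<Sum>j\<in>UNIV. partial_deriv j (partial_deriv j f) y)"

definition harmonic_polynomials :: "nat \<Rightarrow> (real ^ 'n \<Rightarrow> complex) set" where
  "harmonic_polynomials k =
    {p. polynomial_function p
        \<and> (\<forall>t y. p (t *\<^sub>R y) = of_real t ^ k * p y)
        \<and> (\<forall>y. laplacian p y = 0)}"

text \<open>
  The spaces \<open>\<H>\<^sub>k(\<real>\<^sup>n)\<close>. Negative indices occur only for \<open>n = 2\<close>, where there are no polynomials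
  of degree \<open>k < 0\<close>. The elements are then the harmonic functions on the punctured plane that are
  homogeneous of degree \<open>k\<close>, such as \<open>(y\<^sub>1 + i y\<^sub>2)\<^sup>k = \<rho>\<^bsup>2k\<^esup> (y\<^sub>1 - i y\<^sub>2)\<^bsup>-k\<^esup>\<close>. They are written as Kelvin
  transforms of harmonic polynomials of degree \<open>-k\<close>, and they take the value 0 at the origin,
  because \<open>0 powi (2 * k) = 0\<close>.
\<close>

definition \<H> :: "int \<Rightarrow> (real ^ 'n \<Rightarrow> complex) set" where
  "\<H> k =
    (if 0 \<le> k then harmonic_polynomials (nat k)
     else if CARD('n) = 2 then
       {\<lambda>y. of_real (norm y powi (2 * k)) * p y | p. p \<in> harmonic_polynomials (nat (- k))}
     else {\<lambda>y. 0})"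

definition hyp_1F1 :: "complex \<Rightarrow> complex \<Rightarrow> complex \<Rightarrow> complex" where
  "hyp_1F1 a b z = (\<Sum>j. pochhammer a j / pochhammer b j * (z ^ j / fact j))"

definition F :: "complex \<Rightarrow> (real ^ 'n \<Rightarrow> complex) \<Rightarrow> int \<Rightarrow> nat \<Rightarrow> int \<Rightarrow> real \<Rightarrow> real ^ 'n \<Rightarrow> complex" where
  "F s h m l k \<theta> y =
     exp (- \<i> * of_int m * of_real \<theta> / 2) * exp (- \<i> * s * of_real (norm y ^ 2))
     * of_real (norm y ^ (2 * l)) * h y
     * hyp_1F1 (of_int (m + 4 * int l + 2 * k + int CARD('n)) / 4)
               (2 * of_nat l + of_int k + of_nat CARD('n) / 2)
               (2 * \<i> * s * of_real (norm y ^ 2))"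

definition theta_deriv :: "(real \<Rightarrow> real ^ 'n \<Rightarrow> complex) \<Rightarrow> real \<Rightarrow> real ^ 'n \<Rightarrow> complex" where
  "theta_deriv f \<theta> y = vector_derivative (\<lambda>t. f t y) (at \<theta>)"

definition euler_op :: "(real \<Rightarrow> real ^ 'n \<Rightarrow> complex) \<Rightarrow> real \<Rightarrow> real ^ 'n \<Rightarrow> complex" where
  "euler_op f \<theta> y = (\<Sum>j\<in>UNIV. of_real (y $ j) * partial_deriv j (f \<theta>) y)"

definition kappa :: "(real \<Rightarrow> real ^ 'n \<Rightarrow> complex) \<Rightarrow> real \<Rightarrow> real ^ 'n \<Rightarrow> complex" where
  "kappa f \<theta> y = \<i> * theta_deriv f \<theta> y"

definition eta_plus ::
    "complex \<Rightarrow> (real \<Rightarrow> real ^ 'n \<Rightarrow> complex) \<Rightarrow> real \<Rightarrow> real ^ 'n \<Rightarrow> complex" where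
  "eta_plus s f \<theta> y =
     1 / 2 * exp (- 2 * \<i> * of_real \<theta>)
     * (- euler_op f \<theta> y - \<i> * theta_deriv f \<theta> y
        - (of_nat CARD('n) / 2 + 2 * \<i> * s * of_real (norm y ^ 2)) * f \<theta> y)"

definition eta_minus ::
    "complex \<Rightarrow> (real \<Rightarrow> real ^ 'n \<Rightarrow> complex) \<Rightarrow> real \<Rightarrow> real ^ 'n \<Rightarrow> complex" where
  "eta_minus s f \<theta> y =
     1 / 2 * exp (2 * \<i> * of_real \<theta>)
     * (- euler_op f \<theta> y + \<i> * theta_deriv f \<theta> y
        - (of_nat CARD('n) / 2 - 2 * \<i> * s * of_real (norm y ^ 2)) * f \<theta> y)"

definition kappa_eigenvector :: "(real \<Rightarrow> real ^ 'n \<Rightarrow> complex) \<Rightarrow> bool" where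
  "kappa_eigenvector v \<longleftrightarrow>
     v \<noteq> (\<lambda>\<theta> y. 0) \<and> (\<exists>\<mu>. kappa v = (\<lambda>\<theta> y. \<mu> * v \<theta> y))"

definition lowest_weight_vector :: "complex \<Rightarrow> (real \<Rightarrow> real ^ 'n \<Rightarrow> complex) \<Rightarrow> bool" where
  "lowest_weight_vector s v \<longleftrightarrow> kappa_eigenvector v \<and> eta_minus s v = (\<lambda>\<theta> y. 0)"

definition highest_weight_vector :: "complex \<Rightarrow> (real \<Rightarrow> real ^ 'n \<Rightarrow> complex) \<Rightarrow> bool" where
  "highest_weight_vector s v \<longleftrightarrow> kappa_eigenvector v \<and> eta_plus s v = (\<lambda>\<theta> y. 0)"

text \<open>
  The complex linear span of the functions \<open>F\<^bsub>m,l,k\<^esub>\<close>, \<open>m \<equiv> 2k + q (mod 4)\<close>, for fixed \<open>h\<close>, \<open>l\<close>, \<open>k\<close>.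
  The class \<open>q\<close> in \<open>\<int>/4\<int>\<close> is given by an integer representative.
\<close>

definition F_span ::
    "complex \<Rightarrow> (real ^ 'n \<Rightarrow> complex) \<Rightarrow> nat \<Rightarrow> int \<Rightarrow> int \<Rightarrow> (real \<Rightarrow> real ^ 'n \<Rightarrow> complex) set" where
  "F_span s h l k q =
     {\<lambda>\<theta> y. \<Sum>m\<in>M. c m * F s h m l k \<theta> y | M c.
        finite M \<and> M \<subseteq> {m. [m = 2 * k + q] (mod 4)}}"

definition admissible_set :: "nat \<Rightarrow> int set" where
  "admissible_set n = {l * (int n + 2 * j) | l j. 1 \<le> l \<and> l \<le> j + 1}"

definition admissible_eigenvalue :: "nat \<Rightarrow> complex \<Rightarrow> bool" where
  "admissible_eigenvalue n lam \<longleftrightarrow>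
     (if n = 1 then \<exists>l::nat. lam = 1 / 2 * of_nat l * (of_nat l - 1)
      else lam \<in> of_int ` admissible_set n)"

definition admissible_pair :: "nat \<Rightarrow> complex \<Rightarrow> nat \<Rightarrow> int \<Rightarrow> bool" where
  "admissible_pair n lam l k \<longleftrightarrow>
     (if n = 1 then k = 0 \<and> lam = of_nat l * (of_nat l - 1) / 2
      else 1 \<le> l \<and> (n = 2 \<or> 0 \<le> k)
           \<and> lam = of_int (int l * (2 * int l + 2 * k + int n - 2)))"

end

theory Submission
  imports Defs
begin

text \<open>
  On functions that are positively homogeneous along rays, the Euler operator is the derivative at
  \<open>t = 1\<close> of \<open>t \<mapsto> f (t y)\<close>. With \<open>x = 2is\<rho>\<^sup>2\<close> this turns the formulas for \<open>\<eta>\<^sup>+\<close> and \<open>\<eta>\<^sup>-\<close> into the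
  contiguous relations
  \<open>a M(a) + x M'(a) = a M(a+1)\<close> and \<open>x M'(a) = (b-a) M(a-1) - (b-a-x) M(a)\<close>
  for \<open>M(a) = \<^sub>1F\<^sub>1(a, b, x)\<close>, which hold coefficientwise. Characters in \<open>\<theta>\<close> are independent, so a
  \<open>\<kappa>\<close>-eigenvector in the span is a multiple of a single \<open>F\<^sub>m\<close>; since no \<open>F\<^sub>m\<close> vanishes (let \<open>y \<rightarrow> 0\<close> along
  a ray), it is annihilated by \<open>\<eta>\<^sup>+\<close> or \<open>\<eta>\<^sup>-\<close> exactly when the scalar factor is zero.
\<close>

section \<open>The confluent hypergeometric series: convergence, contiguous relations, special
  values\<close>

text \<open>Ratio test: consecutive terms have quotient (a + n)/(b + n) * z/(n + 1), rewritten as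
  \<open>?r n\<close> so that its limit 0 can be read off. The condition on b keeps every
  denominator nonzero.\<close>

lemma hyp_1F1_summable:
  fixes a b z :: complex
  assumes b: "b \<notin> \<int>\<^sub>\<le>\<^sub>0"
  shows "summable (\<lambda>n. pochhammer a n / (pochhammer b n * fact n) * z ^ n)"
proof -
  let ?r = "\<lambda>n. (1 + (a - b) / (b + of_nat n)) * (z / of_nat (Suc n))"
  have bn: "b + of_nat n \<noteq> 0" for n
    using b by (metis add_eq_0_iff2 minus_of_nat_in_nonpos_Ints)
  have "filterlim (\<lambda>n. b + of_nat n) at_infinity sequentially"
    by (rule tendsto_add_filterlim_at_infinity[OF tendsto_const tendsto_of_nat])
  then have "(\<lambda>n. (a - b) / (b + of_nat n)) \<longlonglongrightarrow> 0"
    by (intro tendsto_divide_0[OF tendsto_const])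
  moreover have "(\<lambda>n. z / of_nat (Suc n)) \<longlonglongrightarrow> 0"
    by (intro tendsto_divide_0[OF tendsto_const] filterlim_compose[OF tendsto_of_nat] filterlim_Suc)
  ultimately have "?r \<longlonglongrightarrow> (1 + 0) * 0"
    by (intro tendsto_intros)
  then have "(\<lambda>n. norm (?r n)) \<longlonglongrightarrow> 0"
    by (intro tendsto_norm_zero) simp
  then have "eventually (\<lambda>n. norm (?r n) < 1/2) sequentially"
    by (rule order_tendstoD) simp
  then obtain N where N: "\<And>n. n \<ge> N \<Longrightarrow> norm (?r n) \<le> 1/2"
    by (metis (no_types, lifting) eventually_sequentially less_le)
  let ?f = "\<lambda>n. pochhammer a n / (pochhammer b n * fact n) * z ^ n"
  have step: "?f (Suc n) = ?r n * ?f n" for n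
  proof -
    have "pochhammer b n \<noteq> 0"
      using bn by (metis add.commute add_eq_0_iff pochhammer_eq_0_iff)
    moreover have "?r n = (a + of_nat n) / (b + of_nat n) * (z / of_nat (Suc n))"
      using bn[of n] by (simp add: field_simps)
    ultimately show ?thesis
      using bn[of n] by (simp add: pochhammer_Suc divide_simps)
  qed
  have "norm (?f (Suc n)) \<le> 1/2 * norm (?f n)" if "n \<ge> N" for n
    unfolding step norm_mult[of "?r n"] by (intro mult_right_mono N that norm_ge_zero)
  then show ?thesis
    by (intro summable_ratio_test[where c = "1/2" and N = N]) auto
qed

text \<open>The operator z d/dz multiplies the n-th term by n, so both relations reduce to
  identities between n-th coefficients. They involve the derivative only as z * D, the form in which
  the Euler operator produces it.\<close>

lemma hyp_1F1_contiguous: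
  fixes a b z :: complex
  assumes b: "b \<notin> \<int>\<^sub>\<le>\<^sub>0"
  obtains D where "(hyp_1F1 a b has_field_derivative D) (at z)"
    and "a * hyp_1F1 a b z + z * D = a * hyp_1F1 (a + 1) b z"
    and "z * D = (b - a) * hyp_1F1 (a - 1) b z - (b - a - z) * hyp_1F1 a b z"
proof -
  define c where "c = (\<lambda>a n. pochhammer a n / (pochhammer b n * fact n))"
  have M: "hyp_1F1 a b = (\<lambda>z. \<Sum>n. c a n * z ^ n)" for a
    by (simp add: hyp_1F1_def c_def fun_eq_iff)
  have smb: "summable (\<lambda>n. c a n * z ^ n)" for a z
    unfolding c_def by (rule hyp_1F1_summable[OF b])
  have sm: "(\<lambda>n. c a n * z ^ n) sums hyp_1F1 a b z" for a z
    unfolding M using smb by (rule summable_sums)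
  have bn: "b + of_nat n \<noteq> 0" for n
    using b by (metis add_eq_0_iff2 minus_of_nat_in_nonpos_Ints)
  have pb: "pochhammer b n \<noteq> 0" for n
    using bn by (metis add.commute add_eq_0_iff pochhammer_eq_0_iff)
  define D where "D = (\<Sum>n. diffs (c a) n * z ^ n)"
  have D: "(hyp_1F1 a b has_field_derivative D) (at z)"
    unfolding M D_def by (rule termdiffs_strong_converges_everywhere) (rule smb)
  have "(\<lambda>n. of_nat n * c a n * z ^ (n - Suc 0)) sums D"
    unfolding D_def by (intro diffs_equiv termdiff_converges_all smb)
  then have "(\<lambda>n. z * (of_nat n * c a n * z ^ (n - Suc 0))) sums (z * D)"
    by (rule sums_mult)
  \<comment> \<open>At n = 0 the truncated exponent \<open>n - Suc 0\<close> is 0 rather than -1,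
    but the factor n makes both sides vanish.\<close>
  moreover have "z * (of_nat n * c a n * z ^ (n - Suc 0)) = of_nat n * c a n * z ^ n" for n
    by (cases n) auto
  ultimately have zD: "(\<lambda>n. of_nat n * c a n * z ^ n) sums (z * D)"
    by simp
  have "(\<lambda>n. a * (c a n * z ^ n) + of_nat n * c a n * z ^ n) sums (a * hyp_1F1 a b z + z * D)"
    by (intro sums_add sums_mult sm zD)
  moreover have "a * (c a n * z ^ n) + of_nat n * c a n * z ^ n = a * (c (a + 1) n * z ^ n)" for n
  proof -
    \<comment> \<open>Two expansions of \<open>pochhammer a (Suc n)\<close>: by its last factor and
      by its first.\<close>
    have "(a + of_nat n) * pochhammer a n = a * pochhammer (a + 1) n"
      by (metis pochhammer_rec pochhammer_Suc mult.commute)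
    then have "(a + of_nat n) * c a n = a * c (a + 1) n"
      by (simp add: c_def)
    then show ?thesis
      by (metis distrib_right mult.assoc)
  qed
  ultimately have up: "a * hyp_1F1 a b z + z * D = a * hyp_1F1 (a + 1) b z"
    using sums_mult[OF sm] sums_unique2 by (metis (no_types, lifting) sums_cong)
  \<comment> \<open>\<open>e\<close> is the term sequence of z * M(a): multiplying by z shifts the
    index by one and leaves 0 at n = 0.\<close>
  define e where "e = (\<lambda>n. if n = 0 then 0 else c a (n - 1) * z ^ n)"
  have "(\<lambda>n. e (Suc n)) sums (z * hyp_1F1 a b z)"
    using sums_mult[OF sm[of a z], of z] by (simp add: e_def mult_ac)
  then have e: "e sums (z * hyp_1F1 a b z)"
    using sums_Suc[of e "z * hyp_1F1 a b z"] by (simp add: e_def)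
  have "(\<lambda>n. (b - a) * (c (a - 1) n * z ^ n) - (b - a) * (c a n * z ^ n) + e n) sums
      ((b - a) * hyp_1F1 (a - 1) b z - (b - a) * hyp_1F1 a b z + z * hyp_1F1 a b z)"
    by (intro sums_add sums_diff sums_mult sm e)
  moreover have "(b - a) * (c (a - 1) n * z ^ n) - (b - a) * (c a n * z ^ n) + e n
      = of_nat n * c a n * z ^ n" for n
  proof (cases n)
    case 0
    then show ?thesis by (simp add: c_def e_def)
  next
    case (Suc m)
    have p1: "pochhammer (a - 1) (Suc m) = (a - 1) * pochhammer a m"
      using pochhammer_rec[of "a - 1" m] by simp
    have p2: "pochhammer a (Suc m) = (a + of_nat m) * pochhammer a m"
      by (simp add: pochhammer_Suc mult.commute)
    \<comment> \<open>The shifted coefficient, of index m = n - 1, is brought over the denominator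
      of index n.\<close>
    have p3: "c a m = (of_nat (Suc m) * (b + of_nat m)) * pochhammer a m / (pochhammer b n * fact n)"
      using bn[of m] pb[of m] of_nat_neq_0[where 'a = complex, of m]
      by (simp add: c_def Suc pochhammer_Suc divide_simps del: of_nat_Suc)
    have "(b - a) * c (a - 1) n - (b - a) * c a n + c a m
        = ((b - a) * (a - 1) - (b - a) * (a + of_nat m) + of_nat (Suc m) * (b + of_nat m))
            * pochhammer a m / (pochhammer b n * fact n)"
      unfolding p3 unfolding c_def Suc p1 p2 by (simp add: algebra_simps add_divide_distrib diff_divide_distrib)
    \<comment> \<open>The first two products collect to -(m + 1) * (b - a); adding (m + 1) * (b + m)
      leaves (m + 1) * (a + m).\<close>
    also have "(b - a) * (a - 1) - (b - a) * (a + of_nat m) + of_nat (Suc m) * (b + of_nat m)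
        = of_nat n * (a + of_nat m)"
      by (simp add: Suc algebra_simps)
    also have "of_nat n * (a + of_nat m) * pochhammer a m / (pochhammer b n * fact n) = of_nat n * c a n"
      by (simp add: c_def Suc p2)
    finally have "((b - a) * c (a - 1) n - (b - a) * c a n + c a m) * z ^ n = of_nat n * c a n * z ^ n"
      by simp
    then show ?thesis
      by (simp add: e_def Suc algebra_simps)
  qed
  ultimately have "(b - a) * hyp_1F1 (a - 1) b z - (b - a) * hyp_1F1 a b z + z * hyp_1F1 a b z = z * D"
    using zD sums_unique2 by (metis (no_types, lifting) sums_cong)
  then have down: "z * D = (b - a) * hyp_1F1 (a - 1) b z - (b - a - z) * hyp_1F1 a b z"
    by (simp add: algebra_simps)
  show thesis
    using that D up down by blast
qed

lemma hyp_1F1_at_0 [simp]: "hyp_1F1 a b 0 = 1"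
  using powser_zero[of "\<lambda>n. pochhammer a n / (pochhammer b n * fact n)"]
  by (simp add: hyp_1F1_def)

text \<open>\<open>pochhammer 0 j\<close> vanishes for j > 0. This is the value of the series in the
  highest weight vector.\<close>

lemma hyp_1F1_0_left [simp]: "hyp_1F1 0 b z = 1"
proof -
  have "(\<lambda>j. pochhammer 0 j / pochhammer b j * (z ^ j / fact j)) sums (\<Sum>j\<in>{0}. pochhammer 0 j / pochhammer b j * (z ^ j / fact j))"
    by (intro sums_finite) (auto simp: pochhammer_0_left)
  then show ?thesis
    by (simp add: hyp_1F1_def sums_iff)
qed

text \<open>Equal parameters cancel termwise. In the lowest weight vector this exponential turns
  exp(-i s rho^2) into exp(i s rho^2).\<close>

lemma hyp_1F1_diagonal:
  assumes b: "b \<notin> \<int>\<^sub>\<le>\<^sub>0"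
  shows "hyp_1F1 b b z = exp z"
proof -
  have "pochhammer b n \<noteq> 0" for n
    using b by (metis minus_of_nat_in_nonpos_Ints pochhammer_eq_0_iff)
  then show ?thesis
    by (simp add: hyp_1F1_def exp_def scaleR_conv_of_real divide_inverse mult.commute)
qed

section \<open>Radial derivatives and homogeneous functions\<close>

lemma axis_expansion: "(\<Sum>j\<in>UNIV. (y $ j) *\<^sub>R axis j 1) = (y :: real ^ 'n)"
  using basis_expansion[of y] by (simp add: scalar_mult_eq_scaleR)

text \<open>Chain rule: total differentiability identifies each partial derivative with
  \<open>f'\<close> at a basis vector, and by linearity both sides equal
  \<open>f' y\<close>.\<close>

lemma euler_op_eq_radial_derivative:
  fixes y :: "real ^ 'n"
  assumes f: "f \<theta> differentiable at y"
    and D: "((\<lambda>t. f \<theta> (t *\<^sub>R y)) has_vector_derivative D) (at 1)"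
  shows "euler_op f \<theta> y = D"
proof -
  obtain f' where f': "(f \<theta> has_derivative f') (at y)"
    using f by (auto simp: differentiable_def)
  then interpret bounded_linear f'
    by (rule has_derivative_bounded_linear)
  have "((\<lambda>t. f \<theta> (y + t *\<^sub>R axis j 1)) has_vector_derivative f' (axis j 1)) (at 0)" for j
    unfolding has_vector_derivative_def
    by (rule has_derivative_eq_rhs[OF has_derivative_compose[where g = "f \<theta>" and g' = f']])
      (auto intro!: derivative_eq_intros f' simp: fun_eq_iff scaleR)
  then have p: "partial_deriv j (f \<theta>) y = f' (axis j 1)" for j
    unfolding partial_deriv_def by (rule vector_derivative_at)
  have "((\<lambda>t. f \<theta> (t *\<^sub>R y)) has_vector_derivative f' y) (at 1)"
    unfolding has_vector_derivative_def
    by (rule has_derivative_eq_rhs[OF has_derivative_compose[where g = "f \<theta>" and g' = f']])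
      (auto intro!: derivative_eq_intros f' simp: fun_eq_iff scaleR)
  then have "D = f' y"
    using D by (rule vector_derivative_unique_at[symmetric])
  also have "\<dots> = f' (\<Sum>j\<in>UNIV. (y $ j) *\<^sub>R axis j 1)"
    by (simp only: axis_expansion)
  also have "\<dots> = euler_op f \<theta> y"
    by (simp add: euler_op_def p sum scaleR flip: scaleR_conv_of_real)
  finally show ?thesis ..
qed

text \<open>
  The elements of \<open>\<H>\<^sub>k\<close> with \<open>k < 0\<close> are singular at the origin, so nothing is asked there; only
  homogeneity under positive dilations and differentiability elsewhere enter.
\<close>

definition homogeneous_off_origin :: "int \<Rightarrow> (real ^ 'n \<Rightarrow> complex) \<Rightarrow> bool" where
  "homogeneous_off_origin k h \<longleftrightarrow>
     (\<forall>t>0. \<forall>y. h (t *\<^sub>R y) = of_real t powi k * h y) \<and> (\<forall>y. y \<noteq> 0 \<longrightarrow> h differentiable at y)"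

lemma homogeneous_off_origin_scale:
  "homogeneous_off_origin k h \<Longrightarrow> homogeneous_off_origin k (\<lambda>y. c * h y)"
  by (simp add: homogeneous_off_origin_def)

text \<open>Dilation by 2 fixes the origin, so h 0 is multiplied by 2^k, which is 1 only for k =
  0.\<close>

lemma homogeneous_off_origin_at_0:
  assumes "homogeneous_off_origin k h"
  shows "k = 0 \<or> h 0 = 0"
proof -
  have h: "h 0 = 2 powi k * h 0"
    using assms by (metis homogeneous_off_origin_def of_real_numeral scaleR_zero_right zero_less_numeral)
  have "k = 0" if "(2 :: complex) powi k = 1"
  proof -
    \<comment> \<open>Norms move the equation to the reals, where powers of 2 are strictly monotone
      in the exponent.\<close>
    have "(2 :: real) powi k = norm ((2 :: complex) powi k)"
      by (simp add: norm_power_int)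
    then have "(2 :: real) powi k = 1"
      using that by simp
    then show ?thesis
      using power_int_strict_increasing[of k 0 "2 :: real"] power_int_strict_increasing[of 0 k "2 :: real"]
      by (cases k "0 :: int" rule: linorder_cases) simp_all
  qed
  then show ?thesis
    using h by auto
qed

section \<open>The Euler operator on F\<close>

text \<open>On a ray F becomes a function of the single variable t. The powers of t from rho^(2l)
  and from h merge into one integer power, as k may be negative.\<close>

lemma F_scaleR:
  fixes y :: "real ^ 'n"
  assumes "homogeneous_off_origin k h" "t > 0"
  shows "F s h m l k \<theta> (t *\<^sub>R y) =
    exp (- \<i> * of_int m * of_real \<theta> / 2) * of_real (norm y ^ (2 * l)) * h y
    * (of_real t powi (2 * int l + k) * exp (- \<i> * s * of_real (norm y ^ 2) * of_real t ^ 2)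
       * hyp_1F1 (of_int (m + 4 * int l + 2 * k + int CARD('n)) / 4)
               (2 * of_nat l + of_int k + of_nat CARD('n) / 2)
               (2 * \<i> * s * of_real (norm y ^ 2) * of_real t ^ 2))"
proof -
  have "complex_of_real t powi (2 * int l + k) = of_real t ^ (2 * l) * of_real t powi k"
    using assms(2) by (simp add: power_int_add flip: power_int_of_nat)
  moreover have "h (t *\<^sub>R y) = of_real t powi k * h y"
    using assms by (simp add: homogeneous_off_origin_def)
  ultimately show ?thesis
    using assms(2) by (simp add: F_def power_mult_distrib mult_ac)
qed

lemma F_differentiable:
  fixes y :: "real ^ 'n"
  assumes b: "2 * of_nat l + of_int k + of_nat CARD('n) / 2 \<notin> (\<int>\<^sub>\<le>\<^sub>0 :: complex set)"
    and h: "homogeneous_off_origin k h" and y: "y \<noteq> 0"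
  shows "F s h m l k \<theta> differentiable at y"
proof -
  define a b :: complex
    where "a = of_int (m + 4 * int l + 2 * k + int CARD('n)) / 4"
      and "b = 2 * of_nat l + of_int k + of_nat CARD('n) / 2"
  \<comment> \<open>F is an entire function of rho^2 times h; using \<open>y \<bullet> y\<close>
    instead of \<open>norm y\<close> avoids differentiating a square root.\<close>
  define \<phi> where "\<phi> = (\<lambda>z. exp (- \<i> * of_int m * of_real \<theta> / 2) * exp (- \<i> * s * z) * z ^ l
    * hyp_1F1 a b (2 * \<i> * s * z))"
  have F: "F s h m l k \<theta> = (\<lambda>y. \<phi> (of_real (y \<bullet> y)) * h y)"
    unfolding F_def \<phi>_def a_def b_def power_mult power2_norm_eq_inner
    by (simp add: fun_eq_iff mult_ac)
  have M: "\<exists>D. (hyp_1F1 a b has_field_derivative D) (at z)" for z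
    using hyp_1F1_contiguous[OF assms(1), of a z] unfolding b_def by metis
  have "(\<lambda>z. hyp_1F1 a b (2 * \<i> * s * z)) field_differentiable at z" for z
    using M[of "2 * \<i> * s * z"]
    by (intro field_differentiable_compose[of "\<lambda>z. 2 * \<i> * s * z" _ "hyp_1F1 a b", unfolded o_def])
      (auto intro!: derivative_intros simp: field_differentiable_def)
  moreover have "(\<lambda>z. exp (- \<i> * s * z)) field_differentiable at z" for z
    by (auto simp: field_differentiable_def intro!: exI derivative_eq_intros)
  ultimately have "\<phi> field_differentiable at z" for z
    unfolding \<phi>_def by (intro derivative_intros)
  then have "\<phi> differentiable at (of_real (y \<bullet> y))"
    by (rule field_differentiable_imp_differentiable)
  moreover have "(\<lambda>y. complex_of_real (y \<bullet> y)) differentiable at y"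
    by (rule differentiable_compose[of complex_of_real])
      (auto intro: bounded_linear_imp_differentiable bounded_linear_of_real)
  ultimately have "(\<lambda>y. \<phi> (of_real (y \<bullet> y))) differentiable at y"
    by (rule differentiable_compose)
  then show ?thesis
    using h y unfolding F homogeneous_off_origin_def by (intro differentiable_mult) auto
qed

text \<open>Logarithmic bookkeeping at t = 1 with x = 2 i s rho^2: the power contributes 2l + k, the
  exponential -x, and the hypergeometric factor 2 x D.\<close>

lemma euler_op_F:
  fixes y :: "real ^ 'n"
  assumes b: "2 * of_nat l + of_int k + of_nat CARD('n) / 2 \<notin> (\<int>\<^sub>\<le>\<^sub>0 :: complex set)"
    and h: "homogeneous_off_origin k h"
    and D: "(hyp_1F1 (of_int (m + 4 * int l + 2 * k + int CARD('n)) / 4)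
               (2 * of_nat l + of_int k + of_nat CARD('n) / 2) has_field_derivative D)
              (at (2 * \<i> * s * of_real (norm y ^ 2)))"
  shows "euler_op (F s h m l k) \<theta> y =
    (of_int (2 * int l + k) - 2 * \<i> * s * of_real (norm y ^ 2)) * F s h m l k \<theta> y
    + exp (- \<i> * of_int m * of_real \<theta> / 2) * exp (- \<i> * s * of_real (norm y ^ 2))
     * of_real (norm y ^ (2 * l)) * h y * (2 * (2 * \<i> * s * of_real (norm y ^ 2) * D))"
proof (cases "y = 0")
  \<comment> \<open>At the origin h may be singular, but the coefficients y_j of the Euler operator
    vanish. On the right x = 0, and (2l + k) F is 0: for l > 0 through rho^(2l), for l = 0 and k
    nonzero through h 0 = 0, otherwise through the coefficient.\<close>
  case True
  have "l = 0 \<Longrightarrow> k \<noteq> 0 \<Longrightarrow> h 0 = 0"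
    using homogeneous_off_origin_at_0[OF h] by auto
  then show ?thesis
    using True by (cases "l = 0"; cases "k = 0") (simp_all add: euler_op_def F_def)
next
  case False
  define a b x C :: complex
    where "a = of_int (m + 4 * int l + 2 * k + int CARD('n)) / 4"
      and "b = 2 * of_nat l + of_int k + of_nat CARD('n) / 2"
      and "x = 2 * \<i> * s * of_real (norm y ^ 2)"
      and "C = exp (- \<i> * of_int m * of_real \<theta> / 2) * of_real (norm y ^ (2 * l)) * h y"
  define \<psi> where "\<psi> = (\<lambda>z. C * (z powi (2 * int l + k) * exp (- x / 2 * z ^ 2) * hyp_1F1 a b (x * z ^ 2)))"
  have \<psi>: "F s h m l k \<theta> (t *\<^sub>R y) = \<psi> (of_real t)" if "t > 0" for t
    using F_scaleR[OF h that, of s m l \<theta> y] by (simp add: \<psi>_def C_def a_def b_def x_def mult_ac)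
  define E where "E = C * (exp (- x / 2) * ((of_int (2 * int l + k) - x) * hyp_1F1 a b x + 2 * x * D))"
  have "((\<lambda>z. hyp_1F1 a b (x * z ^ 2)) has_field_derivative D * (2 * x)) (at 1)"
    by (rule DERIV_chain2[where f = "hyp_1F1 a b"])
      (use D in \<open>auto intro!: derivative_eq_intros simp: a_def b_def x_def\<close>)
  then have "(\<psi> has_field_derivative E) (at (of_real 1))"
    unfolding \<psi>_def E_def by (auto intro!: derivative_eq_intros simp: algebra_simps)
  then have "((\<lambda>t. \<psi> (of_real t)) has_vector_derivative E) (at 1)"
    by (rule has_vector_derivative_real_field)
  \<comment> \<open>\<open>\<psi>\<close> agrees with F only for t > 0, an open set containing
    1.\<close>
  then have "((\<lambda>t. F s h m l k \<theta> (t *\<^sub>R y)) has_vector_derivative E) (at 1)"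
    by (rule has_vector_derivative_transform_within_open[where S = "{0<..}"]) (auto simp: \<psi>)
  then have "euler_op (F s h m l k) \<theta> y = E"
    by (intro euler_op_eq_radial_derivative F_differentiable b h False)
  moreover have "F s h m l k \<theta> y = C * exp (- x / 2) * hyp_1F1 a b x"
    by (simp add: F_def C_def a_def b_def x_def mult_ac)
  moreover have "exp (- \<i> * of_int m * of_real \<theta> / 2) * exp (- \<i> * s * of_real (norm y ^ 2))
     * of_real (norm y ^ (2 * l)) * h y = C * exp (- x / 2)"
    by (simp add: C_def x_def mult_ac)
  ultimately show ?thesis
    unfolding E_def by (simp only: flip: x_def) (simp add: algebra_simps)
qed

section \<open>The action of kappa, \<open>eta_plus\<close> and \<open>eta_minus\<close> on
  F\<close>

lemma F_eq_character: "F s h m l k \<theta> y = exp (- \<i> * of_int m * of_real \<theta> / 2) * F s h m l k 0 y"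
  by (simp add: F_def mult_ac)

lemma character_has_vector_derivative:
  "((\<lambda>\<theta>. exp (- \<i> * of_int m * of_real \<theta> / 2)) has_vector_derivative
     - \<i> * of_int m / 2 * exp (- \<i> * of_int m * of_real \<theta> / 2)) (at \<theta>)"
  by (rule has_vector_derivative_real_field[where f = "\<lambda>z. exp (- \<i> * of_int m * z / 2)"])
    (auto intro!: derivative_eq_intros)

lemma F_has_vector_derivative_theta:
  "((\<lambda>\<theta>. F s h m l k \<theta> y) has_vector_derivative - \<i> * of_int m / 2 * F s h m l k \<theta> y) (at \<theta>)"
proof -
  define C where "C = F s h m l k 0 y"
  have F: "F s h m l k \<theta> y = exp (- \<i> * of_int m * of_real \<theta> / 2) * C" for \<theta>
    unfolding C_def by (rule F_eq_character)
  show ?thesis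
    unfolding F using has_vector_derivative_mult_left[OF character_has_vector_derivative[of m \<theta>], of C]
    by (simp only: mult.assoc)
qed

lemma theta_deriv_F: "theta_deriv (F s h m l k) \<theta> y = - \<i> * of_int m / 2 * F s h m l k \<theta> y"
  unfolding theta_deriv_def by (rule vector_derivative_at[OF F_has_vector_derivative_theta])

lemma kappa_F: "kappa (F s h m l k) = (\<lambda>\<theta> y. of_int m / 2 * F s h m l k \<theta> y)"
  by (simp add: kappa_def theta_deriv_F fun_eq_iff mult.assoc)

text \<open>The factor exp(-2 i theta) raises m by 4 and hence a by 1, so the first contiguous
  relation is the one that matches.\<close>

lemma eta_plus_F:
  fixes h :: "real ^ 'n \<Rightarrow> complex"
  assumes b: "2 * of_nat l + of_int k + of_nat CARD('n) / 2 \<notin> (\<int>\<^sub>\<le>\<^sub>0 :: complex set)"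
    and h: "homogeneous_off_origin k h"
  shows "eta_plus s (F s h m l k) =
    (\<lambda>\<theta> y. - (of_int (m + 4 * int l + 2 * k + int CARD('n)) / 4) * F s h (m + 4) l k \<theta> y)"
proof (intro ext)
  fix \<theta> and y :: "real ^ 'n"
  define a b x A :: complex
    where "a = of_int (m + 4 * int l + 2 * k + int CARD('n)) / 4"
      and "b = 2 * of_nat l + of_int k + of_nat CARD('n) / 2"
      and "x = 2 * \<i> * s * of_real (norm y ^ 2)"
      and "A = exp (- \<i> * of_int m * of_real \<theta> / 2) * exp (- \<i> * s * of_real (norm y ^ 2))
                 * of_real (norm y ^ (2 * l)) * h y"
  obtain D where D: "(hyp_1F1 a b has_field_derivative D) (at x)"
    and up: "a * hyp_1F1 a b x + x * D = a * hyp_1F1 (a + 1) b x"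
    using hyp_1F1_contiguous[OF assms(1)] unfolding b_def by metis
  have E: "euler_op (F s h m l k) \<theta> y = (of_int (2 * int l + k) - x) * (A * hyp_1F1 a b x) + A * (2 * (x * D))"
    using euler_op_F[OF b h D[unfolded a_def b_def x_def], of \<theta>]
    by (simp add: F_def a_def b_def x_def A_def)
  have F: "F s h m l k \<theta> y = A * hyp_1F1 a b x"
    by (simp add: F_def A_def a_def b_def x_def)
  have "exp (- \<i> * of_int (m + 4) * of_real \<theta> / 2)
      = exp (- 2 * \<i> * of_real \<theta>) * exp (- \<i> * of_int m * of_real \<theta> / 2)"
    unfolding exp_add[symmetric] by (rule arg_cong[of _ _ exp]) (simp add: field_simps)
  moreover have "of_int (m + 4 + 4 * int l + 2 * k + int CARD('n)) / 4 = a + 1"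
    by (simp add: a_def field_simps)
  ultimately have F': "F s h (m + 4) l k \<theta> y = exp (- 2 * \<i> * of_real \<theta>) * A * hyp_1F1 (a + 1) b x"
    by (simp only: F_def A_def b_def x_def mult.assoc)
  \<comment> \<open>The multiples of x cancel, and 2l + k + m/2 + n/2 = 2a.\<close>
  have step: "- euler_op (F s h m l k) \<theta> y - \<i> * theta_deriv (F s h m l k) \<theta> y
      - (of_nat CARD('n) / 2 + x) * F s h m l k \<theta> y = - 2 * A * (a * hyp_1F1 a b x + x * D)"
    unfolding E theta_deriv_F F by (simp add: a_def field_simps)
  show "eta_plus s (F s h m l k) \<theta> y =
      - (of_int (m + 4 * int l + 2 * k + int CARD('n)) / 4) * F s h (m + 4) l k \<theta> y"
    by (simp only: eta_plus_def step F' up flip: a_def x_def) (simp add: algebra_simps)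
qed

text \<open>Here exp(2 i theta) lowers m by 4 and a by 1, which calls for the second contiguous
  relation and its scalar b - a.\<close>

lemma eta_minus_F:
  fixes h :: "real ^ 'n \<Rightarrow> complex"
  assumes b: "2 * of_nat l + of_int k + of_nat CARD('n) / 2 \<notin> (\<int>\<^sub>\<le>\<^sub>0 :: complex set)"
    and h: "homogeneous_off_origin k h"
  shows "eta_minus s (F s h m l k) =
    (\<lambda>\<theta> y. - (of_int (- m + 4 * int l + 2 * k + int CARD('n)) / 4) * F s h (m - 4) l k \<theta> y)"
proof (intro ext)
  fix \<theta> and y :: "real ^ 'n"
  define a b x A :: complex
    where "a = of_int (m + 4 * int l + 2 * k + int CARD('n)) / 4"
      and "b = 2 * of_nat l + of_int k + of_nat CARD('n) / 2"
      and "x = 2 * \<i> * s * of_real (norm y ^ 2)"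
      and "A = exp (- \<i> * of_int m * of_real \<theta> / 2) * exp (- \<i> * s * of_real (norm y ^ 2))
                 * of_real (norm y ^ (2 * l)) * h y"
  obtain D where D: "(hyp_1F1 a b has_field_derivative D) (at x)"
    and down: "x * D = (b - a) * hyp_1F1 (a - 1) b x - (b - a - x) * hyp_1F1 a b x"
    using hyp_1F1_contiguous[OF assms(1)] unfolding b_def by metis
  have E: "euler_op (F s h m l k) \<theta> y = (of_int (2 * int l + k) - x) * (A * hyp_1F1 a b x) + A * (2 * (x * D))"
    using euler_op_F[OF b h D[unfolded a_def b_def x_def], of \<theta>]
    by (simp add: F_def a_def b_def x_def A_def)
  have F: "F s h m l k \<theta> y = A * hyp_1F1 a b x"
    by (simp add: F_def A_def a_def b_def x_def)
  have "exp (- \<i> * of_int (m - 4) * of_real \<theta> / 2)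
      = exp (2 * \<i> * of_real \<theta>) * exp (- \<i> * of_int m * of_real \<theta> / 2)"
    unfolding exp_add[symmetric] by (rule arg_cong[of _ _ exp]) (simp add: field_simps)
  moreover have "of_int (m - 4 + 4 * int l + 2 * k + int CARD('n)) / 4 = a - 1"
    by (simp add: a_def field_simps)
  ultimately have F': "F s h (m - 4) l k \<theta> y = exp (2 * \<i> * of_real \<theta>) * A * hyp_1F1 (a - 1) b x"
    by (simp only: F_def A_def b_def x_def mult.assoc)
  have ba: "of_int (- m + 4 * int l + 2 * k + int CARD('n)) / 4 = b - a"
    by (simp add: a_def b_def field_simps)
  \<comment> \<open>The multiples of x add up to 2x, and 2l + k + n/2 - m/2 = 2(b - a).\<close>
  have "- euler_op (F s h m l k) \<theta> y + \<i> * theta_deriv (F s h m l k) \<theta> y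
      - (of_nat CARD('n) / 2 - x) * F s h m l k \<theta> y = - 2 * A * ((b - a - x) * hyp_1F1 a b x + x * D)"
    unfolding E theta_deriv_F F by (simp add: a_def b_def field_simps)
  also have "(b - a - x) * hyp_1F1 a b x + x * D = (b - a) * hyp_1F1 (a - 1) b x"
    unfolding down by simp
  finally show "eta_minus s (F s h m l k) \<theta> y =
      - (of_int (- m + 4 * int l + 2 * k + int CARD('n)) / 4) * F s h (m - 4) l k \<theta> y"
    by (simp only: eta_minus_def F' ba flip: x_def) (simp add: algebra_simps)
qed

section \<open>Independence of characters and kappa-eigenvectors in the span\<close>

text \<open>Induction on the set of frequencies: divide the relation by the character of
  \<open>m0\<close>, then differentiate. The constant \<open>c m0\<close> disappears, and each
  remaining coefficient acquires a factor proportional to m - m0, which is nonzero.\<close>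

lemma characters_independent:
  assumes "finite M" "\<And>\<theta>. (\<Sum>m\<in>M. c m * exp (- \<i> * of_int m * of_real \<theta> / 2)) = 0" "m \<in> M"
  shows "c m = 0"
  using assms
proof (induction M arbitrary: c m rule: finite_induct)
  case empty
  then show ?case by simp
next
  case (insert m0 M)
  let ?e = "\<lambda>m \<theta>. exp (- \<i> * of_int m * of_real \<theta> / 2)"
  have e: "?e m \<theta> = ?e (m - m0) \<theta> * ?e m0 \<theta>" for m \<theta>
    unfolding exp_add[symmetric] by (rule arg_cong[of _ _ exp]) (simp add: field_simps)
  have const: "(\<Sum>m\<in>M. c m * ?e (m - m0) \<theta>) = - c m0" for \<theta>
  proof -
    have "((\<Sum>m\<in>M. c m * ?e (m - m0) \<theta>) + c m0) * ?e m0 \<theta>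
        = c m0 * ?e m0 \<theta> + (\<Sum>m\<in>M. c m * (?e (m - m0) \<theta> * ?e m0 \<theta>))"
      by (simp add: sum_distrib_right distrib_right mult.assoc)
    also have "\<dots> = (\<Sum>m\<in>insert m0 M. c m * ?e m \<theta>)"
      by (simp only: e[symmetric] sum.insert[OF insert.hyps])
    finally show ?thesis
      unfolding insert.prems(1) by (simp add: eq_neg_iff_add_eq_0)
  qed
  have "(\<Sum>m\<in>M. c m * (- \<i> * of_int (m - m0) / 2 * ?e (m - m0) \<theta>)) = 0" for \<theta>
  proof -
    have "((\<lambda>\<theta>. \<Sum>m\<in>M. c m * ?e (m - m0) \<theta>) has_vector_derivative
        (\<Sum>m\<in>M. c m * (- \<i> * of_int (m - m0) / 2 * ?e (m - m0) \<theta>))) (at \<theta>)"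
      by (intro has_vector_derivative_sum has_vector_derivative_mult_right character_has_vector_derivative)
    then show ?thesis
      unfolding const using has_vector_derivative_const vector_derivative_unique_at by blast
  qed
  moreover have "(\<Sum>m\<in>M. c m * (- \<i> * of_int (m - m0) / 2) * ?e m \<theta>)
      = (\<Sum>m\<in>M. c m * (- \<i> * of_int (m - m0) / 2 * ?e (m - m0) \<theta>)) * ?e m0 \<theta>" for \<theta>
    unfolding sum_distrib_right by (rule sum.cong, rule refl, subst e, simp only: mult.assoc)
  ultimately have "(\<Sum>m\<in>M. c m * (- \<i> * of_int (m - m0) / 2) * ?e m \<theta>) = 0" for \<theta>
    by simp
  \<comment> \<open>The induction hypothesis is applied to the modified coefficients, which is why
    \<open>c\<close> is arbitrary in the induction.\<close>
  then have M: "c m * (- \<i> * of_int (m - m0) / 2) = 0" if "m \<in> M" for m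
    using insert.IH[of "\<lambda>m. c m * (- \<i> * of_int (m - m0) / 2)"] that by blast
  then have M: "c m = 0" if "m \<in> M" for m
    using that insert.hyps by fastforce
  then have "c m0 = 0"
    using const[of 0] by simp
  then show ?case
    using M insert.prems(2) by blast
qed

lemma F_cmult: "F s (\<lambda>y. c * h y) m l k = (\<lambda>\<theta> y. c * F s h m l k \<theta> y)"
  by (simp add: F_def fun_eq_iff)

text \<open>For fixed y, kappa v - mu v is a combination of characters in theta, so all its
  coefficients vanish. The scalar of the surviving term is absorbed into h, so that criteria stated
  for F apply directly.\<close>

lemma F_span_eigenvector:
  fixes h :: "real ^ 'n \<Rightarrow> complex"
  assumes "v \<in> F_span s h l k q" "kappa_eigenvector v"
  obtains m c where "[m = 2 * k + q] (mod 4)" "c \<noteq> 0" "v = F s (\<lambda>y. c * h y) m l k"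
proof -
  obtain M c where M: "finite M" "M \<subseteq> {m. [m = 2 * k + q] (mod 4)}"
    and v: "v = (\<lambda>\<theta> y. \<Sum>m\<in>M. c m * F s h m l k \<theta> y)"
    using assms(1) by (auto simp: F_span_def)
  obtain \<mu> where \<mu>: "kappa v = (\<lambda>\<theta> y. \<mu> * v \<theta> y)"
    using assms(2) by (auto simp: kappa_eigenvector_def)
  have kv: "kappa v \<theta> y = (\<Sum>m\<in>M. c m * (of_int m / 2 * F s h m l k \<theta> y))" for \<theta> y
  proof -
    have "((\<lambda>\<theta>. v \<theta> y) has_vector_derivative
        (\<Sum>m\<in>M. c m * (- \<i> * of_int m / 2 * F s h m l k \<theta> y))) (at \<theta>)"
      unfolding v by (intro has_vector_derivative_sum has_vector_derivative_mult_right F_has_vector_derivative_theta)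
    then have "theta_deriv v \<theta> y = (\<Sum>m\<in>M. c m * (- \<i> * of_int m / 2 * F s h m l k \<theta> y))"
      unfolding theta_deriv_def by (rule vector_derivative_at)
    then have "kappa v \<theta> y = (\<Sum>m\<in>M. \<i> * (c m * (- \<i> * of_int m / 2 * F s h m l k \<theta> y)))"
      by (simp add: kappa_def sum_distrib_left)
    also have "\<dots> = (\<Sum>m\<in>M. c m * (of_int m / 2 * F s h m l k \<theta> y))"
      by (rule sum.cong) (simp_all add: algebra_simps)
    finally show ?thesis .
  qed
  have zero: "c m * (of_int m / 2 - \<mu>) * F s h m l k 0 y = 0" if "m \<in> M" for m y
  proof (rule characters_independent[OF M(1) _ that])
    fix \<theta>
    have "(\<Sum>m\<in>M. c m * (of_int m / 2 - \<mu>) * F s h m l k 0 y * exp (- \<i> * of_int m * of_real \<theta> / 2))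
        = (\<Sum>m\<in>M. c m * (of_int m / 2 * F s h m l k \<theta> y) - \<mu> * (c m * F s h m l k \<theta> y))"
      by (rule sum.cong) (simp_all add: F_eq_character[of _ _ _ _ _ \<theta>] algebra_simps)
    also have "\<dots> = kappa v \<theta> y - \<mu> * v \<theta> y"
      unfolding kv by (simp add: v sum_subtractf sum_distrib_left)
    also have "\<dots> = 0"
      by (simp add: \<mu>)
    finally show "(\<Sum>m\<in>M. c m * (of_int m / 2 - \<mu>) * F s h m l k 0 y * exp (- \<i> * of_int m * of_real \<theta> / 2)) = 0" .
  qed
  obtain \<theta>0 y0 where "v \<theta>0 y0 \<noteq> 0"
    using assms(2) by (auto simp: kappa_eigenvector_def fun_eq_iff)
  \<comment> \<open>A summand that is nonzero at the chosen point fixes mu = m0/2; every other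
    summand then vanishes identically.\<close>
  then obtain m0 where m0: "m0 \<in> M" "c m0 * F s h m0 l k \<theta>0 y0 \<noteq> 0"
    unfolding v by (metis (no_types, lifting) sum.neutral)
  then have "\<mu> = of_int m0 / 2"
    using zero[OF m0(1), of y0] F_eq_character[of s h m0 l k \<theta>0 y0] by auto
  then have other: "c m * F s h m l k \<theta> y = 0" if "m \<in> M" "m \<noteq> m0" for m \<theta> y
    using zero[OF that(1), of y] that(2) F_eq_character[of s h m l k \<theta> y] by auto
  have "v \<theta> y = c m0 * F s h m0 l k \<theta> y" for \<theta> y
    using sum.mono_neutral_right[OF M(1), of "{m0}" "\<lambda>m. c m * F s h m l k \<theta> y"] m0(1) other
    by (auto simp: v)
  then have "v = F s (\<lambda>y. c m0 * h y) m0 l k"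
    by (simp add: F_cmult fun_eq_iff)
  moreover have "[m0 = 2 * k + q] (mod 4)" "c m0 \<noteq> 0"
    using m0 M(2) by auto
  ultimately show thesis
    using that by blast
qed

section \<open>Nonvanishing of F and the weight vector criteria\<close>

text \<open>On the ray through y all other factors are nonzero, so F = 0 would force the
  hypergeometric factor to be 0 for all t > 0; but it tends to 1 as t tends to 0.\<close>

lemma F_nonzero:
  fixes y :: "real ^ 'n"
  assumes b: "2 * of_nat l + of_int k + of_nat CARD('n) / 2 \<notin> (\<int>\<^sub>\<le>\<^sub>0 :: complex set)"
    and h: "homogeneous_off_origin k h" and y: "y \<noteq> 0" "h y \<noteq> 0"
  shows "F s h m l k \<noteq> (\<lambda>\<theta> y. 0)"
proof
  assume F0: "F s h m l k = (\<lambda>\<theta> y. 0)"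
  define a b :: complex
    where "a = of_int (m + 4 * int l + 2 * k + int CARD('n)) / 4"
      and "b = 2 * of_nat l + of_int k + of_nat CARD('n) / 2"
  define g where "g = (\<lambda>t::real. hyp_1F1 a b (2 * \<i> * s * of_real (norm y ^ 2) * of_real t ^ 2))"
  have "g t = 0" if "t > 0" for t
    using F_scaleR[OF h that, of s m l 0 y] y that by (simp add: F0 g_def a_def b_def)
  then have "eventually (\<lambda>t. 0 = g t) (at_right 0)"
    by (simp add: eventually_at_right_less eventually_mono[OF eventually_at_right_less])
  then have lim0: "(g \<longlongrightarrow> 0) (at_right 0)"
    by (rule Lim_transform_eventually[OF tendsto_const])
  obtain D where "(hyp_1F1 a b has_field_derivative D) (at 0)"
    using hyp_1F1_contiguous[OF assms(1)] unfolding b_def by metis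
  then have cont: "isCont (hyp_1F1 a b) 0"
    by (rule DERIV_isCont)
  have "((\<lambda>t. 2 * \<i> * s * of_real (norm y ^ 2) * of_real t ^ 2) \<longlongrightarrow> 2 * \<i> * s * of_real (norm y ^ 2) * of_real 0 ^ 2) (at_right (0::real))"
    by (intro tendsto_intros)
  then have "(g \<longlongrightarrow> hyp_1F1 a b 0) (at_right 0)"
    unfolding g_def by (intro isCont_tendsto_compose[OF cont]) simp
  then show False
    using lim0 tendsto_unique trivial_limit_at_right_real by (metis hyp_1F1_at_0 zero_neq_one)
qed

text \<open>\<open>F_nonzero\<close> enters twice: at m, to have an eigenvector, and at m - 4, so
  that only a zero scalar can make the image vanish.\<close>

lemma lowest_weight_vector_F_iff:
  fixes y :: "real ^ 'n"
  assumes b: "2 * of_nat l + of_int k + of_nat CARD('n) / 2 \<notin> (\<int>\<^sub>\<le>\<^sub>0 :: complex set)"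
    and h: "homogeneous_off_origin k h" and y: "y \<noteq> 0" "h y \<noteq> 0"
  shows "lowest_weight_vector s (F s h m l k) \<longleftrightarrow> m = 2 * k + 4 * int l + int CARD('n)"
proof -
  have "(\<lambda>\<theta> y. c * F s h (m - 4) l k \<theta> y) = (\<lambda>\<theta> y. 0) \<longleftrightarrow> c = 0" for c
    using F_nonzero[OF b h y, of s "m - 4"] by (auto simp: fun_eq_iff)
  moreover have "kappa_eigenvector (F s h m l k)"
    using F_nonzero[OF b h y] kappa_F unfolding kappa_eigenvector_def by blast
  moreover have "- (of_int j / 4) = (0 :: complex) \<longleftrightarrow> j = 0" for j
    by simp
  ultimately show ?thesis
    unfolding lowest_weight_vector_def eta_minus_F[OF b h] by (simp only: HOL.simp_thms) presburger
qed

lemma highest_weight_vector_F_iff: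
  fixes y :: "real ^ 'n"
  assumes b: "2 * of_nat l + of_int k + of_nat CARD('n) / 2 \<notin> (\<int>\<^sub>\<le>\<^sub>0 :: complex set)"
    and h: "homogeneous_off_origin k h" and y: "y \<noteq> 0" "h y \<noteq> 0"
  shows "highest_weight_vector s (F s h m l k) \<longleftrightarrow> m = - (2 * k + 4 * int l + int CARD('n))"
proof -
  have "(\<lambda>\<theta> y. c * F s h (m + 4) l k \<theta> y) = (\<lambda>\<theta> y. 0) \<longleftrightarrow> c = 0" for c
    using F_nonzero[OF b h y, of s "m + 4"] by (auto simp: fun_eq_iff)
  moreover have "kappa_eigenvector (F s h m l k)"
    using F_nonzero[OF b h y] kappa_F unfolding kappa_eigenvector_def by blast
  moreover have "- (of_int j / 4) = (0 :: complex) \<longleftrightarrow> j = 0" for j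
    by simp
  ultimately show ?thesis
    unfolding highest_weight_vector_def eta_plus_F[OF b h] by (simp only: HOL.simp_thms) presburger
qed

lemma F_in_F_span: "[m = 2 * k + q] (mod 4) \<Longrightarrow> F s h m l k \<in> F_span s h l k q"
  unfolding F_span_def by (rule CollectI, rule exI[of _ "{m}"], rule exI[of _ "\<lambda>_. 1"]) simp

section \<open>Admissible pairs and the spaces \<open>\<H> k\<close>\<close>

text \<open>The second hypergeometric parameter has positive real part: 2l + k is nonnegative and
  n/2 is positive. Hence no denominator of the series vanishes.\<close>

lemma admissible_pair_parameter:
  assumes "admissible_eigenvalue CARD('n) lam" "admissible_pair CARD('n) lam l k"
  shows "2 * of_nat l + of_int k + of_nat CARD('n::finite) / 2 \<notin> (\<int>\<^sub>\<le>\<^sub>0 :: complex set)"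
proof -
  \<comment> \<open>For \<open>n = 2\<close> the index \<open>k\<close> may be negative, but \<open>lam > 0\<close> forces \<open>l + k > 0\<close>.\<close>
  have "2 * int l + k \<ge> 0"
  proof (cases "CARD('n) = 2")
    case True
    obtain l' j' where l': "1 \<le> l'" "l' \<le> j' + 1" "lam = of_int (l' * (2 + 2 * j'))"
      using assms(1) True by (auto simp: admissible_eigenvalue_def admissible_set_def)
    have l: "lam = of_int (int l * (2 * int l + 2 * k))"
      using assms(2) True by (auto simp: admissible_pair_def)
    have "int l * (2 * int l + 2 * k) = l' * (2 + 2 * j')"
      using l l'(3) of_int_eq_iff[where 'a = complex] by metis
    moreover have "l' * (2 + 2 * j') > 0"
      using l'(1,2) by (intro mult_pos_pos) auto
    ultimately have "int l * (2 * int l + 2 * k) > 0"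
      by simp
    then have "2 * int l + 2 * k > 0"
      by (simp add: zero_less_mult_iff)
    then show ?thesis by linarith
  next
    case False
    then have "k \<ge> 0"
      using assms(2) by (auto simp: admissible_pair_def split: if_splits)
    then show ?thesis by simp
  qed
  then have "real_of_int (2 * int l + k) \<ge> 0"
    by linarith
  then have "Re (2 * of_nat l + of_int k + of_nat CARD('n) / 2) > 0"
    by (simp add: add_nonneg_pos)
  then show ?thesis
    by (auto elim!: nonpos_Ints_cases simp: complex_eq_iff)
qed

text \<open>For k < 0 the Kelvin factor scales by t^(2k) and the polynomial by t^(-k), together
  t^k.\<close>

lemma \<H>_homogeneous_off_origin:
  fixes h :: "real ^ 'n \<Rightarrow> complex"
  assumes "h \<in> \<H> k"
  shows "homogeneous_off_origin k h"
proof -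
  consider "k \<ge> 0" "h \<in> harmonic_polynomials (nat k)"
    | p where "k < 0" "p \<in> harmonic_polynomials (nat (- k))" "h = (\<lambda>y. of_real (norm y powi (2 * k)) * p y)"
    | "h = (\<lambda>y. 0)"
    using assms by (auto simp: \<H>_def split: if_splits)
  then show ?thesis
  proof cases
    case 1
    then show ?thesis
      by (auto simp: homogeneous_off_origin_def harmonic_polynomials_def power_int_def
          differentiable_at_polynomial_function)
  next
    case (2 p)
    have "h (t *\<^sub>R y) = of_real t powi k * h y" if "t > 0" for t y
    proof -
      have "complex_of_real t powi (2 * k) * of_real t ^ nat (- k) = of_real t powi (2 * k) * of_real t powi (- k)"
        using 2(1) by (simp add: power_int_def)
      also have "\<dots> = of_real t powi k"
        using that by (simp flip: power_int_add)
      finally show ?thesis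
        using 2(2) that
        by (simp add: 2(3) harmonic_polynomials_def power_int_mult_distrib of_real_power_int mult_ac)
    qed
    moreover have "h differentiable at y" if "y \<noteq> 0" for y
    proof -
      \<comment> \<open>The Kelvin factor \<open>norm y powi (2 * k)\<close> is treated as an
        integer power of the inner product, smooth away from 0.\<close>
      have "((\<lambda>y. (y \<bullet> y) powi k) has_derivative
          (\<lambda>v. (y \<bullet> v + v \<bullet> y) * (of_int k * (y \<bullet> y) powi (k - 1)))) (at y)"
        using that by (intro has_derivative_power_int has_derivative_inner has_derivative_ident) auto
      then have "(\<lambda>y. (y \<bullet> y) powi k) differentiable at y"
        by (rule differentiableI)
      then have "(\<lambda>y. complex_of_real ((y \<bullet> y) powi k)) differentiable at y"
        by (rule differentiable_compose[OF bounded_linear_imp_differentiable[OF bounded_linear_of_real]])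
      moreover have "norm y powi (2 * k) = (y \<bullet> y) powi k" for y :: "real ^ 'n"
        unfolding power2_norm_eq_inner[symmetric] power_int_mult by (simp only: power_int_numeral)
      moreover have "p differentiable at y"
        using 2(2) by (simp add: harmonic_polynomials_def differentiable_at_polynomial_function)
      ultimately show ?thesis
        unfolding 2(3) by (simp only: differentiable_mult)
    qed
    ultimately show ?thesis
      by (simp add: homogeneous_off_origin_def)
  next
    case 3
    then show ?thesis by (simp add: homogeneous_off_origin_def)
  qed
qed

text \<open>Supplies the ray needed for \<open>F_nonzero\<close>. A nonzero value at the origin
  forces k = 0, and then h takes the same value at a basis vector.\<close>

lemma \<H>_nonzero_off_origin:
  fixes h :: "real ^ 'n \<Rightarrow> complex"
  assumes "h \<in> \<H> k" "h \<noteq> (\<lambda>y. 0)"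
  obtains y where "y \<noteq> 0" "h y \<noteq> 0"
proof -
  obtain y0 where y0: "h y0 \<noteq> 0"
    using assms(2) by auto
  show thesis
  proof (cases "y0 = 0")
    case True
    then have "k = 0"
      using homogeneous_off_origin_at_0[OF \<H>_homogeneous_off_origin[OF assms(1)]] y0 by auto
    then have "h \<in> harmonic_polynomials 0"
      using assms(1) by (simp add: \<H>_def)
    \<comment> \<open>Polynomial homogeneity also covers t = 0; since 0 ^ 0 = 1 it compares h at the
      origin with h at a basis vector.\<close>
    then have "h (0 *\<^sub>R axis undefined 1) = of_real 0 ^ 0 * h (axis undefined 1)"
      unfolding harmonic_polynomials_def by blast
    then have "h (axis undefined 1) \<noteq> 0"
      using y0 True by simp
    then show thesis
      using that[of "axis undefined 1"] by (simp add: axis_eq_0_iff)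
  next
    case False
    then show thesis using y0 that by blast
  qed
qed

theorem theorem2:
  fixes s lam :: complex and q k :: int and l :: nat and h :: "real ^ 'n \<Rightarrow> complex"
  assumes "admissible_eigenvalue CARD('n) lam"
    and "admissible_pair CARD('n) lam l k"
    and "h \<in> \<H> k"
    and "h \<noteq> (\<lambda>y. 0)"
  shows "(\<forall>m. [m = 2 * k + q] (mod 4) \<longrightarrow>
            kappa (F s h m l k) = (\<lambda>\<theta> y. of_int m / 2 * F s h m l k \<theta> y)
          \<and> eta_plus s (F s h m l k) =
              (\<lambda>\<theta> y. - (of_int (m + 4 * int l + 2 * k + int CARD('n)) / 4) * F s h (m + 4) l k \<theta> y)
          \<and> eta_minus s (F s h m l k) =
              (\<lambda>\<theta> y. - (of_int (- m + 4 * int l + 2 * k + int CARD('n)) / 4) * F s h (m - 4) l k \<theta> y))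
      \<and> ((\<exists>v\<in>F_span s h l k q. lowest_weight_vector s v) \<longleftrightarrow> [q = int CARD('n)] (mod 4))
      \<and> ([q = int CARD('n)] (mod 4) \<longrightarrow>
            F s h (2 * k + 4 * int l + int CARD('n)) l k =
              (\<lambda>\<theta> y. exp (- (1 / 2) * of_int (2 * k + 4 * int l + int CARD('n)) * \<i> * of_real \<theta>)
                     * exp (\<i> * s * of_real (norm y ^ 2)) * of_real (norm y ^ (2 * l)) * h y)
          \<and> F s h (2 * k + 4 * int l + int CARD('n)) l k \<in> F_span s h l k q
          \<and> lowest_weight_vector s (F s h (2 * k + 4 * int l + int CARD('n)) l k))
      \<and> ((\<exists>v\<in>F_span s h l k q. highest_weight_vector s v) \<longleftrightarrow> [q + int CARD('n) = 0] (mod 4))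
      \<and> ([q + int CARD('n) = 0] (mod 4) \<longrightarrow>
            F s h (- (2 * k + 4 * int l + int CARD('n))) l k =
              (\<lambda>\<theta> y. exp (1 / 2 * of_int (2 * k + 4 * int l + int CARD('n)) * \<i> * of_real \<theta>)
                     * exp (- \<i> * s * of_real (norm y ^ 2)) * of_real (norm y ^ (2 * l)) * h y)
          \<and> F s h (- (2 * k + 4 * int l + int CARD('n))) l k \<in> F_span s h l k q
          \<and> highest_weight_vector s (F s h (- (2 * k + 4 * int l + int CARD('n))) l k))"
    (is "?ops \<and> (?low \<longleftrightarrow> _) \<and> (_ \<longrightarrow> ?low_eq \<and> _) \<and> (?high \<longleftrightarrow> _) \<and> (_ \<longrightarrow> ?high_eq \<and> _)")
proof -
  note b = admissible_pair_parameter[OF assms(1,2)]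
  note h = \<H>_homogeneous_off_origin[OF assms(3)]
  obtain y where y: "y \<noteq> 0" "h y \<noteq> 0"
    using \<H>_nonzero_off_origin[OF assms(3,4)] by blast
  let ?w = "2 * k + 4 * int l + int CARD('n)"
  have ops: ?ops
    by (intro allI impI conjI kappa_F eta_plus_F[OF b h] eta_minus_F[OF b h])
  \<comment> \<open>At m = \<open>?w\<close> the first parameter equals the second, so the series is
    an exponential.\<close>
  have a: "of_int (?w + 4 * int l + 2 * k + int CARD('n)) / 4 = 2 * of_nat l + of_int k + (of_nat CARD('n) / 2 :: complex)"
    by simp
  have e: "exp (- (\<i> * (s * z))) * exp (\<i> * (s * (2 * z))) = exp (\<i> * (s * z))" for z
    by (simp flip: exp_add)
  have low_eq: ?low_eq
    unfolding F_def a hyp_1F1_diagonal[OF b] by (simp add: fun_eq_iff mult_ac e)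
  \<comment> \<open>Only the character needs rewriting: at m = \<open>- ?w\<close> the first
    parameter is 0 and the series is 1.\<close>
  have "- \<i> * of_int (- ?w) * of_real \<theta> / 2 = 1 / 2 * of_int ?w * \<i> * of_real \<theta>" for \<theta>
    by (simp only: of_int_minus minus_mult_minus mult_minus_left mult_minus_right minus_minus) simp
  then have high_eq: ?high_eq
    unfolding F_def by (simp only: fun_eq_iff) simp
  have low: "lowest_weight_vector s (F s h ?w l k)"
    by (simp add: lowest_weight_vector_F_iff[OF b h y])
  have high: "highest_weight_vector s (F s h (- ?w) l k)"
    by (simp add: highest_weight_vector_F_iff[OF b h y])
  \<comment> \<open>\<open>?w - 2 * k\<close> is congruent to n modulo 4.\<close>
  have low_cong: "[?w = 2 * k + q] (mod 4) \<longleftrightarrow> [q = int CARD('n)] (mod 4)"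
    unfolding cong_iff_dvd_diff by presburger
  \<comment> \<open>\<open>- ?w - 2 * k\<close> is congruent to -n modulo 4, since the multiples of
    k add up to -4k.\<close>
  have high_cong: "[- ?w = 2 * k + q] (mod 4) \<longleftrightarrow> [q + int CARD('n) = 0] (mod 4)"
    unfolding cong_iff_dvd_diff by presburger
  have scale: "homogeneous_off_origin k (\<lambda>y. c * h y)" for c
    by (rule homogeneous_off_origin_scale[OF h])
  have low_only: "[q = int CARD('n)] (mod 4)" if v: "v \<in> F_span s h l k q" "lowest_weight_vector s v" for v
  proof -
    obtain m c where m: "[m = 2 * k + q] (mod 4)" "c \<noteq> 0" "v = F s (\<lambda>y. c * h y) m l k"
      using F_span_eigenvector[OF v(1)] v(2) unfolding lowest_weight_vector_def by metis
    \<comment> \<open>The criterion is used for the rescaled function c * h, which is still nonzero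
      at y because c is nonzero.\<close>
    then have "m = ?w"
      using lowest_weight_vector_F_iff[OF b scale y(1)] v(2) y(2) by simp
    then show ?thesis
      using m(1) low_cong by simp
  qed
  have high_only: "[q + int CARD('n) = 0] (mod 4)"
    if v: "v \<in> F_span s h l k q" "highest_weight_vector s v" for v
  proof -
    obtain m c where m: "[m = 2 * k + q] (mod 4)" "c \<noteq> 0" "v = F s (\<lambda>y. c * h y) m l k"
      using F_span_eigenvector[OF v(1)] v(2) unfolding highest_weight_vector_def by metis
    then have "m = - ?w"
      using highest_weight_vector_F_iff[OF b scale y(1)] v(2) y(2) by simp
    then show ?thesis
      using m(1) high_cong by simp
  qed
  have low_in: "F s h ?w l k \<in> F_span s h l k q" if "[q = int CARD('n)] (mod 4)"
    using that low_cong by (intro F_in_F_span) blast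
  have high_in: "F s h (- ?w) l k \<in> F_span s h l k q" if "[q + int CARD('n) = 0] (mod 4)"
    using that high_cong by (intro F_in_F_span) blast
  have "?low \<longleftrightarrow> [q = int CARD('n)] (mod 4)"
    using low_only low_in low by blast
  moreover have "?high \<longleftrightarrow> [q + int CARD('n) = 0] (mod 4)"
    using high_only high_in high by blast
  ultimately show ?thesis
    by (intro conjI impI ops low_eq low_in low high_eq high_in high)
qed

end
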